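(* There is an algorithm which, given an integer $N\ge1$ and real numbers $\lambda_1\ge\lambda_2\ge\dots\ge\lambda_N>0$, $\sigma_\epsilon^2\ge0$, $C_I>0$, $C_{EH}>0$, uses $O(N^2)$ elementary operations and either correctly reports infeasibility of, or outputs an optimal solution of, the mixed-integer nonlinear optimization problem in the variables $(P_i,\pi_i)_{i\in\mathcal{N}}$, $\mathcal{N}=\{1,\dots,N\}$, $$\min\ P=\sum_{i\in\mathcal{N}}P_i\quad\text{s.t.}\quad \sum_{i\in\mathcal{N}}\log\left(1+\frac{\pi_iP_i\lambda_i}{1+\sigma_\epsilon^2P}\right)\ge C_I,\quad \sum_{i\in\mathcal{N}}(1-\pi_i)(P_i\lambda_i+\sigma_\epsilon^2P)\ge C_{EH},$$ $$P_i\ge0,\quad\pi_i\in\{0,1\},\quad i\in\mathcal{N}.$$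
   Context: $\log$ denotes the logarithm to base 2. Elementary operations are arithmetic operations and comparisons on real numbers, evaluation of $2^{x}$, and extraction of $n$-th roots of positive reals for $1\le n\le N$, each at unit cost (exact real arithmetic). This is the case of no upper bound on the individual powers $P_i$. *)

theory Defs
  imports Complex_Main "HOL-Library.Landau_Symbols"
begin

section \<open>The optimization problem\<close>

text \<open>
  Subchannels are the indices \<open>1..N\<close>; the values of \<open>lam\<close>, \<open>p\<close>, \<open>q\<close> outside this range are
  irrelevant.  \<open>p\<close> stands for the powers \<open>P\<^sub>i\<close>, \<open>q\<close> for the selectors \<open>\<pi>\<^sub>i\<close>, and \<open>s\<close> for the
  variance \<open>\<sigma>\<^sub>\<epsilon>\<^sup>2\<close> itself, not for its square root.
\<close>

definition total_power :: "nat \<Rightarrow> (nat \<Rightarrow> real) \<Rightarrow> real" where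
  "total_power N p = (\<Sum>i = 1..N. p i)"

definition feasible ::
  "nat \<Rightarrow> (nat \<Rightarrow> real) \<Rightarrow> real \<Rightarrow> real \<Rightarrow> real \<Rightarrow> (nat \<Rightarrow> real) \<Rightarrow> (nat \<Rightarrow> real) \<Rightarrow> bool" where
  "feasible N lam s C_I C_EH p q \<longleftrightarrow>
     (\<Sum>i = 1..N. log 2 (1 + q i * p i * lam i / (1 + s * total_power N p))) \<ge> C_I \<and>
     (\<Sum>i = 1..N. (1 - q i) * (p i * lam i + s * total_power N p)) \<ge> C_EH \<and>
     (\<forall>i\<in>{1..N}. p i \<ge> 0 \<and> q i \<in> {0, 1})"

definition optimal ::
  "nat \<Rightarrow> (nat \<Rightarrow> real) \<Rightarrow> real \<Rightarrow> real \<Rightarrow> real \<Rightarrow> (nat \<Rightarrow> real) \<Rightarrow> (nat \<Rightarrow> real) \<Rightarrow> bool" where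
  "optimal N lam s C_I C_EH p q \<longleftrightarrow>
     is_arg_min (\<lambda>(p, q). total_power N p) (\<lambda>(p, q). feasible N lam s C_I C_EH p q) (p, q)"

definition valid_input ::
  "nat \<Rightarrow> (nat \<Rightarrow> real) \<Rightarrow> real \<Rightarrow> real \<Rightarrow> real \<Rightarrow> bool" where
  "valid_input N lam s C_I C_EH \<longleftrightarrow>
     N \<ge> 1 \<and> (\<forall>i\<in>{1..<N}. lam i \<ge> lam (Suc i)) \<and> lam N > 0 \<and> s \<ge> 0 \<and> C_I > 0 \<and> C_EH > 0"


section \<open>Algorithms: programs for a real random access machine\<close>

text \<open>
  A program is a finite text that does not depend on \<open>N\<close> or on the data.  Real registers and real
  arrays hold exact real numbers; natural-number registers serve only as array indices, loop
  counters and degrees of roots, and can only be set, copied, incremented, decremented and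
  compared.  There is no way to convert a real number into a natural number, and the only real
  constants in a program are integers.
\<close>

type_synonym name = string

record state =
  ireg :: "name \<Rightarrow> nat"
  rreg :: "name \<Rightarrow> real"
  rarr :: "name \<Rightarrow> nat \<Rightarrow> real"

datatype arith = Add | Sub | Mul | Div

datatype instr =
    RConst name int
  | RCopy name name
  | Arith arith name name name
  | Exp2 name name
  | Root name name name
  | Load name name name
  | Store name name name
  | IConst name nat
  | ICopy name name
  | IInc name
  | IDec name

datatype test =
    RLess name name
  | RLe name name
  | REq name name
  | ILess name name
  | ILe name name
  | IEq name name

datatype prog =
    Skip
  | Do instr
  | Seq prog prog  (infixr \<open>;;\<close> 60)
  | Cond test prog prog
  | Loop test prog

fun arith_val :: "arith \<Rightarrow> real \<Rightarrow> real \<Rightarrow> real option" where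
  "arith_val Add x y = Some (x + y)"
| "arith_val Sub x y = Some (x - y)"
| "arith_val Mul x y = Some (x * y)"
| "arith_val Div x y = (if y = 0 then None else Some (x / y))"

definition set_ireg :: "name \<Rightarrow> nat \<Rightarrow> state \<Rightarrow> state" where
  "set_ireg i n st = st\<lparr>ireg := (ireg st)(i := n)\<rparr>"

definition set_rreg :: "name \<Rightarrow> real \<Rightarrow> state \<Rightarrow> state" where
  "set_rreg x v st = st\<lparr>rreg := (rreg st)(x := v)\<rparr>"

definition set_rarr :: "name \<Rightarrow> nat \<Rightarrow> real \<Rightarrow> state \<Rightarrow> state" where
  "set_rarr a k v st = st\<lparr>rarr := (rarr st)(a := (rarr st a)(k := v))\<rparr>"

text \<open>
  The result \<open>None\<close> means that the instruction is undefined and the machine is stuck: division by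
  zero, and any root other than an \<open>n\<close>-th root of a positive real with \<open>1 \<le> n \<le> N\<close>.  The first
  argument \<open>N\<close> is used only for this bound.  Destinations come first, except in
  \<open>Store a i x\<close>, which writes \<open>x\<close> to cell \<open>i\<close> of the array \<open>a\<close>.
\<close>

fun step :: "nat \<Rightarrow> instr \<Rightarrow> state \<Rightarrow> state option" where
  "step N (RConst x c) st = Some (set_rreg x (of_int c) st)"
| "step N (RCopy x y) st = Some (set_rreg x (rreg st y) st)"
| "step N (Arith f x y z) st =
     map_option (\<lambda>v. set_rreg x v st) (arith_val f (rreg st y) (rreg st z))"
| "step N (Exp2 x y) st = Some (set_rreg x (2 powr rreg st y) st)"
| "step N (Root x i y) st =
     (if 1 \<le> ireg st i \<and> ireg st i \<le> N \<and> rreg st y > 0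
      then Some (set_rreg x (root (ireg st i) (rreg st y)) st) else None)"
| "step N (Load x a i) st = Some (set_rreg x (rarr st a (ireg st i)) st)"
| "step N (Store a i x) st = Some (set_rarr a (ireg st i) (rreg st x) st)"
| "step N (IConst i n) st = Some (set_ireg i n st)"
| "step N (ICopy i j) st = Some (set_ireg i (ireg st j) st)"
| "step N (IInc i) st = Some (set_ireg i (ireg st i + 1) st)"
| "step N (IDec i) st = Some (set_ireg i (ireg st i - 1) st)"

fun holds :: "test \<Rightarrow> state \<Rightarrow> bool" where
  "holds (RLess x y) st \<longleftrightarrow> rreg st x < rreg st y"
| "holds (RLe x y) st \<longleftrightarrow> rreg st x \<le> rreg st y"
| "holds (REq x y) st \<longleftrightarrow> rreg st x = rreg st y"
| "holds (ILess i j) st \<longleftrightarrow> ireg st i < ireg st j"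
| "holds (ILe i j) st \<longleftrightarrow> ireg st i \<le> ireg st j"
| "holds (IEq i j) st \<longleftrightarrow> ireg st i = ireg st j"

text \<open>
  \<open>exec N c st t st'\<close>: started in \<open>st\<close>, the program \<open>c\<close> terminates in \<open>st'\<close> after \<open>t\<close> operations.
  Every executed instruction and every evaluated test costs one unit; besides the elementary
  operations on reals this also charges for data movement and index handling.
\<close>

inductive exec :: "nat \<Rightarrow> prog \<Rightarrow> state \<Rightarrow> nat \<Rightarrow> state \<Rightarrow> bool" for N :: nat where
  Skip: "exec N Skip st 0 st"
| Do: "step N a st = Some st' \<Longrightarrow> exec N (Do a) st 1 st'"
| Seq: "exec N c st t st' \<Longrightarrow> exec N d st' u st'' \<Longrightarrow> exec N (c ;; d) st (t + u) st''"
| CondTrue: "holds b st \<Longrightarrow> exec N c st t st' \<Longrightarrow> exec N (Cond b c d) st (1 + t) st'"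
| CondFalse: "\<not> holds b st \<Longrightarrow> exec N d st t st' \<Longrightarrow> exec N (Cond b c d) st (1 + t) st'"
| LoopFalse: "\<not> holds b st \<Longrightarrow> exec N (Loop b c) st 1 st"
| LoopTrue: "holds b st \<Longrightarrow> exec N c st t st' \<Longrightarrow> exec N (Loop b c) st' u st'' \<Longrightarrow>
    exec N (Loop b c) st (1 + t + u) st''"

inductive_cases SkipE: "exec N Skip st t st'"
inductive_cases DoE: "exec N (Do a) st t st'"
inductive_cases SeqE: "exec N (c ;; d) st t st'"
inductive_cases CondE: "exec N (Cond b c d) st t st'"
inductive_cases LoopE: "exec N (Loop b c) st t st'"

lemma exec_deterministic:
  "exec N c st t st' \<Longrightarrow> exec N c st u st'' \<Longrightarrow> t = u \<and> st' = st''"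
proof (induction arbitrary: u st'' rule: exec.induct)
  case (Skip st)
  then show ?case by (rule SkipE) simp
next
  case (Do a st st')
  from Do.prems show ?case
    by (rule DoE) (use Do.hyps in simp_all)
next
  case (Seq c st t st1 d v st2)
  from Seq.prems show ?case
    by (rule SeqE) (use Seq.IH in metis)
next
  case (CondTrue b st c t st' d)
  from CondTrue.prems show ?case
    by (rule CondE) (use CondTrue.IH CondTrue.hyps(1) in \<open>metis plus_1_eq_Suc add_Suc\<close>)+
next
  case (CondFalse b st d t st' c)
  from CondFalse.prems show ?case
    by (rule CondE) (use CondFalse.IH CondFalse.hyps(1) in \<open>metis plus_1_eq_Suc add_Suc\<close>)+
next
  case (LoopFalse b st c)
  from LoopFalse.prems show ?case
    by (rule LoopE) (use LoopFalse.hyps in simp_all)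
next
  case (LoopTrue b st c t st1 v st2)
  from LoopTrue.prems show ?case
    by (rule LoopE) (use LoopTrue.IH LoopTrue.hyps(1) in \<open>metis plus_1_eq_Suc add_Suc\<close>)+
qed


section \<open>Input and output conventions\<close>

text \<open>
  All registers and array cells that do not carry input are zero initially; in particular the
  values of \<open>lam\<close> outside \<open>1..N\<close> are not available to the program.
\<close>

definition initial :: "nat \<Rightarrow> (nat \<Rightarrow> real) \<Rightarrow> real \<Rightarrow> real \<Rightarrow> real \<Rightarrow> state" where
  "initial N lam s C_I C_EH =
     \<lparr>ireg = (\<lambda>_. 0)(''N'' := N),
      rreg = (\<lambda>_. 0)(''sigma2'' := s, ''C_I'' := C_I, ''C_EH'' := C_EH),
      rarr = (\<lambda>_ _. 0)(''lambda'' := (\<lambda>i. if i \<in> {1..N} then lam i else 0))\<rparr>"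

text \<open>
  The natural-number register \<open>status\<close> is 0 for a report of infeasibility, and 1 if the arrays
  \<open>P\<close> and \<open>pi\<close> hold a solution in their cells \<open>1..N\<close>.
\<close>

definition correct_output ::
  "nat \<Rightarrow> (nat \<Rightarrow> real) \<Rightarrow> real \<Rightarrow> real \<Rightarrow> real \<Rightarrow> state \<Rightarrow> bool" where
  "correct_output N lam s C_I C_EH st \<longleftrightarrow>
     ireg st ''status'' = 0 \<and> (\<nexists>p q. feasible N lam s C_I C_EH p q) \<or>
     ireg st ''status'' = 1 \<and> optimal N lam s C_I C_EH (rarr st ''P'') (rarr st ''pi'')"

end

theory Submission
  imports Defs
begin

text \<open>
  All harvesting power may be spent on the best harvesting channel \<open>j\<close>.  By an exchange argument
  the information channels may then be taken to be the \<open>k\<close> strongest of the others, and those that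
  water-filling leaves without power may be turned into harvesting channels, which only helps.
  With no inactive channel left, the water level is an explicit \<open>k\<close>-th root, and the least total
  power compatible with a given pair \<open>(j, k)\<close> solves a linear inequality.  The algorithm
  searches all pairs, updating product and sum of inverses of the gains incrementally.

  That some pair is at least as good as a given feasible point is shown without convex
  duality: the tangent of the logarithm at the water level bounds the rate from above.
\<close>

section \<open>Optimal power allocation\<close>

text \<open>After subtracting \<open>c\<close> throughout, terms of \<open>T\<close> are nonnegative
  and those of \<open>S - T\<close> nonpositive, so passing from \<open>S\<close> to
  \<open>T\<close> cannot lower the sum.\<close>

lemma sum_exchange:
  fixes h :: "'a \<Rightarrow> real"
  assumes "finite S" "finite T" and "\<And>l. l \<in> T \<Longrightarrow> c \<le> h l" and "\<And>l. l \<in> S - T \<Longrightarrow> h l \<le> c"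
  shows "sum h S \<le> sum h T + (real (card S) - real (card T)) * c"
proof -
  have "(\<Sum>l\<in>S. h l - c) = (\<Sum>l\<in>S \<inter> T. h l - c) + (\<Sum>l\<in>S - T. h l - c)"
    using assms(1) by (subst sum.union_disjoint[symmetric]) (auto intro: sum.cong)
  also have "(\<Sum>l\<in>S - T. h l - c) \<le> 0"
    using assms(4) by (intro sum_nonpos) auto
  also have "(\<Sum>l\<in>S \<inter> T. h l - c) + 0 \<le> (\<Sum>l\<in>T. h l - c)"
    using assms(2,3) by (auto intro: sum_mono2)
  finally show ?thesis
    by (simp add: sum_subtractf algebra_simps)
qed

text \<open>With \<open>y = \<nu> * a\<close> for positive \<open>\<nu>\<close> and
  \<open>a\<close>, this is the maximum of \<open>ln (1 + x * a) - x / \<nu>\<close> over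
  nonnegative \<open>x\<close>, attained at \<open>x = \<nu> - 1 / a\<close> if
  \<open>1 \<le> y\<close> and at \<open>x = 0\<close> otherwise.\<close>

definition rate_excess :: "real \<Rightarrow> real" where
  "rate_excess y = (if 1 \<le> y then ln y + 1 / y - 1 else 0)"

lemma rate_excess_mono:
  assumes "x \<le> y"
  shows "rate_excess x \<le> rate_excess y"
proof -
  have *: "ln x + 1 / x - 1 \<le> ln y + 1 / y - 1" if "1 \<le> x" "x \<le> y" for x y :: real
  proof -
    have "ln (x / y) \<le> x / y - 1"
      using that by (intro ln_le_minus_one) auto
    moreover have "ln (x / y) = ln x - ln y"
      using that by (intro ln_divide_pos) auto
    moreover have "1 / x - 1 / y \<le> 1 - x / y"
    proof -
      have "1 / x - 1 / y = (y - x) / y / x"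
        using that by (simp add: field_simps)
      also have "\<dots> \<le> (y - x) / y"
        using that by (intro divide_le_eq_1[THEN iffD2] iffD2[OF pos_divide_le_eq])
          (auto simp: mult_le_cancel_left1)
      finally show ?thesis
        using that by (simp add: diff_divide_distrib)
    qed
    ultimately show ?thesis by linarith
  qed
  \<comment> \<open>The two branches of the definition meet at 1 with value 0; the instance at 1 and
    \<open>y\<close> covers \<open>x < 1 \<le> y\<close>.\<close>
  show ?thesis
    using *[of x y] *[of 1 y] assms by (auto simp: rate_excess_def)
qed

lemma rate_excess_nonneg: "0 \<le> rate_excess y"
  using rate_excess_mono[of "min y 0" y] by (simp add: rate_excess_def split: if_splits)

text \<open>The logarithm lies below its tangent at \<open>\<nu> * a\<close> if that is at least 1,
  and otherwise below its tangent at 1, whose slope in \<open>x\<close> is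
  \<open>a < 1 / \<nu>\<close>.\<close>

lemma rate_tangent:
  fixes x a \<nu> :: real
  assumes "0 \<le> x" "0 < a" "0 < \<nu>"
  shows "ln (1 + x * a) \<le> rate_excess (\<nu> * a) + x / \<nu>"
proof (cases "1 \<le> \<nu> * a")
  case True
  have pos: "0 < 1 + x * a" "0 < \<nu> * a"
    using assms by (auto intro: add_pos_nonneg)
  have "ln ((1 + x * a) / (\<nu> * a)) \<le> (1 + x * a) / (\<nu> * a) - 1"
    using pos by (intro ln_le_minus_one) auto
  moreover have "ln ((1 + x * a) / (\<nu> * a)) = ln (1 + x * a) - ln (\<nu> * a)"
    using pos by (intro ln_divide_pos) auto
  moreover have "(1 + x * a) / (\<nu> * a) = 1 / (\<nu> * a) + x / \<nu>"
    using assms by (simp add: field_simps)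
  ultimately show ?thesis
    using True by (simp add: rate_excess_def)
next
  case False
  have "ln (1 + x * a) \<le> x * a"
    using assms by (intro ln_add_one_self_le_self) auto
  also have "\<dots> \<le> x * (1 / \<nu>)"
    using False assms by (intro mult_left_mono) (auto simp: field_simps)
  finally show ?thesis
    using False by (simp add: rate_excess_def)
qed

section \<open>Water levels, demands and candidate pairs\<close>

locale swipt =
  fixes N :: nat and lam :: "nat \<Rightarrow> real" and s C_I C_EH :: real
  assumes input: "valid_input N lam s C_I C_EH"
begin

lemma s_nonneg: "0 \<le> s" and C_I_pos: "0 < C_I" and C_EH_pos: "0 < C_EH"
  using input by (auto simp: valid_input_def)

lemma lam_antimono:
  assumes "1 \<le> i" "i \<le> j" "j \<le> N"
  shows "lam j \<le> lam i"
  using assms(2,3)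
proof (induction rule: dec_induct)
  case (step n)
  moreover have "lam (Suc n) \<le> lam n"
    using input assms(1) step by (auto simp: valid_input_def)
  ultimately show ?case by simp
qed simp

lemma lam_pos: "i \<in> {1..N} \<Longrightarrow> 0 < lam i"
  using lam_antimono[of i N] input by (force simp: valid_input_def)

text \<open>
  The number of information channels is replaced as a parameter by the index \<open>i\<close> of the weakest
  one.  \<open>level\<close> and \<open>demand\<close> are the water level and the total information power in units of the
  noise \<open>1 + s P\<close>, which makes them independent of the total power \<open>P\<close>.
\<close>
definition chan :: "nat \<Rightarrow> nat \<Rightarrow> nat set" where
  "chan j i = {1..i} - {j}"

text \<open>A common active level \<open>\<nu>\<close> on \<open>k\<close> channels gives as rate
  the binary logarithm of \<open>\<nu> ^ k\<close> times the product of their gains; this is the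
  value of \<open>\<nu> ^ k\<close> at rate \<open>C_I\<close>.\<close>

definition quot :: "nat \<Rightarrow> nat \<Rightarrow> real" where
  "quot j i = 2 powr C_I / (\<Prod>l\<in>chan j i. lam l)"

definition level :: "nat \<Rightarrow> nat \<Rightarrow> real" where
  "level j i = root (card (chan j i)) (quot j i)"

definition demand :: "nat \<Rightarrow> nat \<Rightarrow> real" where
  "demand j i = real (card (chan j i)) * level j i - (\<Sum>l\<in>chan j i. 1 / lam l)"

text \<open>Two lower bounds on the total power \<open>P\<close>: the information power
  \<open>(1 + s * P) * demand j i\<close> must fit into \<open>P\<close>, and the remainder, all on
  channel \<open>j\<close>, must harvest \<open>C_EH\<close> together with the \<open>s * P\<close>
  of each harvesting channel.\<close>

definition min_power :: "nat \<Rightarrow> nat \<Rightarrow> real" where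
  "min_power j i =
     max (demand j i / (1 - s * demand j i))
         ((demand j i + C_EH / lam j) /
          (1 - s * demand j i + (real N - real (card (chan j i))) * s / lam j))"

text \<open>As \<open>i\<close> is the weakest channel of \<open>chan j i\<close>, its activity
  implies that of all others; \<open>s * demand j i < 1\<close> keeps the denominators of
  \<open>min_power\<close> positive.\<close>

definition candidates :: "(nat \<times> nat) set" where
  "candidates =
     {(j, i). j \<in> {1..N} \<and> i \<in> {1..N} - {j} \<and> 1 / lam i \<le> level j i \<and> s * demand j i < 1}"

lemma finite_chan [simp]: "finite (chan j i)"
  by (simp add: chan_def)

lemma chan_subset: "i \<le> N \<Longrightarrow> chan j i \<subseteq> {1..N}"
  by (auto simp: chan_def)

lemma prod_chan_pos: "i \<le> N \<Longrightarrow> 0 < (\<Prod>l\<in>chan j i. lam l)"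
  using chan_subset lam_pos by (intro prod_pos) blast

lemma quot_pos: "i \<le> N \<Longrightarrow> 0 < quot j i"
  using prod_chan_pos by (simp add: quot_def)

lemma card_chan_pos: "i \<in> {1..N} - {j} \<Longrightarrow> 0 < card (chan j i)"
  by (auto simp: card_gt_0_iff chan_def)

lemma level_pos: "i \<in> {1..N} - {j} \<Longrightarrow> 0 < level j i"
  using quot_pos card_chan_pos by (simp add: level_def real_root_gt_zero)

lemma level_power: "i \<in> {1..N} - {j} \<Longrightarrow> level j i ^ card (chan j i) = quot j i"
  using quot_pos[of i j] card_chan_pos[of i j] by (simp add: level_def)

lemma level_active:
  assumes "i \<in> {1..N} - {j}" "1 / lam i \<le> level j i" "l \<in> chan j i"
  shows "1 / lam l \<le> level j i" and "1 \<le> level j i * lam l"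
proof -
  have l: "l \<in> {1..N}" "l \<le> i" "1 \<le> l"
    using assms by (auto simp: chan_def)
  have "1 / lam l \<le> 1 / lam i"
    using l assms(1) lam_antimono[of l i] lam_pos[of l] lam_pos[of i] by (auto simp: frac_le)
  then show "1 / lam l \<le> level j i"
    using assms(2) by linarith
  then show "1 \<le> level j i * lam l"
    using lam_pos[OF l(1)] by (simp add: field_simps)
qed

text \<open>The product of the gains cancels the denominator of \<open>quot\<close>, so
  water-filling at this level, with all channels active, has rate exactly
  \<open>C_I\<close>.\<close>

lemma sum_ln_level:
  assumes "i \<in> {1..N} - {j}"
  shows "(\<Sum>l\<in>chan j i. ln (level j i * lam l)) = C_I * ln 2"
proof -
  have "(\<Sum>l\<in>chan j i. ln (level j i * lam l)) = ln (\<Prod>l\<in>chan j i. level j i * lam l)"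
  proof (subst ln_prod)
    show "level j i * lam l \<noteq> 0" if "l \<in> chan j i" for l
      using that level_pos[OF assms] lam_pos[of l] chan_subset[of i j] assms by force
  qed simp_all
  also have "(\<Prod>l\<in>chan j i. level j i * lam l) = quot j i * (\<Prod>l\<in>chan j i. lam l)"
    using assms by (simp add: prod.distrib level_power)
  also have "\<dots> = 2 powr C_I"
  proof -
    have "(\<Prod>l\<in>chan j i. lam l) \<noteq> 0"
      using prod_chan_pos[of i j] assms by (intro less_imp_neq[THEN not_sym]) auto
    from iffD1[OF nonzero_eq_divide_eq[OF this] quot_def] show ?thesis .
  qed
  finally show ?thesis
    by (simp add: ln_powr)
qed

section \<open>Water-filling lower bound on the information power\<close>

text \<open>For the next index \<open>i'\<close> after \<open>i\<close>,
  \<open>(level j i' * lam i') ^ Suc k\<close> equals \<open>(level j i * lam i') ^ k\<close>, so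
  failing the test at its own level makes \<open>i'\<close> inactive at the level of
  \<open>i\<close>. Later channels are no stronger.\<close>

lemma next_inactive:
  assumes i: "i \<in> {1..N} - {j}" and l: "l \<in> {1..N} - {j}" "i < l"
    and next_level: "\<And>i'. i' \<in> {1..N} - {j} \<Longrightarrow> card (chan j i') = Suc (card (chan j i)) \<Longrightarrow>
       level j i' < 1 / lam i'"
  shows "level j i * lam l < 1"
proof -
  \<comment> \<open>\<open>i'\<close> skips \<open>j\<close>; it does not pass \<open>l\<close>,
    which is beyond \<open>i\<close> and differs from \<open>j\<close>.\<close>
  define i' where "i' = (if Suc i = j then Suc (Suc i) else Suc i)"
  have i': "i' \<in> {1..N} - {j}" "i' \<le> l"
    using i l by (auto simp: i'_def)
  have ch: "chan j i' = insert i' (chan j i)" "i' \<notin> chan j i"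
    using i by (auto simp: chan_def i'_def)
  define k where "k = card (chan j i)"
  have k: "0 < k" "card (chan j i') = Suc k"
    using card_chan_pos[OF i] ch by (auto simp: k_def)
  have li': "0 < lam i'" and ll: "0 < lam l"
    using i' l lam_pos by blast+
  have "level j i' * lam i' < 1"
    using next_level[OF i'(1)] k li' by (simp add: k_def field_simps)
  then have "(level j i' * lam i') ^ Suc k < 1"
    using level_pos[OF i'(1)] li' by (intro power_less_one_iff[THEN iffD2]) auto
  moreover have "(level j i' * lam i') ^ Suc k = quot j i' * lam i' ^ Suc k"
    using level_power[OF i'(1)] k by (simp add: power_mult_distrib)
  moreover have "quot j i' = quot j i / lam i'"
    using ch by (simp add: quot_def)
  ultimately have "quot j i * lam i' ^ k < 1"
    using li' by simp
  then have "(level j i * lam i') ^ k < 1"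
    using level_power[OF i] by (simp add: power_mult_distrib k_def)
  then have "level j i * lam i' < 1"
    by (meson not_less one_le_power)
  moreover have "level j i * lam l \<le> level j i * lam i'"
    using level_pos[OF i] i' l lam_antimono[of i' l] by (intro mult_left_mono) auto
  ultimately show ?thesis by linarith
qed

text \<open>
  \<open>i\<close> is the last index for which all of \<open>chan j i\<close> is active and not larger than \<open>S\<close>; either the
  two sets are equally large or, by \<open>next_inactive\<close>, no channel outside \<open>chan j i\<close> is active at
  this level.
\<close>
lemma water_filling_bound:
  assumes S: "S \<subseteq> {1..N} - {j}" and x: "\<And>l. l \<in> S \<Longrightarrow> 0 \<le> x l"
    and rate: "C_I \<le> (\<Sum>l\<in>S. log 2 (1 + x l * lam l))"
  shows "\<exists>i\<in>{1..N} - {j}. 1 / lam i \<le> level j i \<and> card (chan j i) \<le> card S \<and>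
           demand j i \<le> sum x S"
proof -
  define G where "G = {i \<in> {1..N} - {j}. card (chan j i) \<le> card S \<and> 1 / lam i \<le> level j i}"
  have finS: "finite S"
    using S finite_subset by blast
  have "S \<noteq> {}"
    using rate C_I_pos by auto
  then have Sc: "1 \<le> card S"
    using finS by (simp add: Suc_le_eq card_gt_0_iff)
  \<comment> \<open>The first index other than \<open>j\<close>: its set is a singleton with level
    \<open>2 powr C_I / lam i0\<close>, at least \<open>1 / lam i0\<close>, so \<open>G\<close> is
    nonempty.\<close>
  define i0 :: nat where "i0 = (if j = 1 then 2 else 1)"
  obtain l0 where "l0 \<in> S" using \<open>S \<noteq> {}\<close> by blast
  then have "l0 \<in> {1..N} - {j}" using S by blast
  then have i0: "i0 \<in> {1..N} - {j}"
    by (auto simp: i0_def)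
  have c0: "chan j i0 = {i0}"
    by (auto simp: i0_def chan_def)
  have "i0 \<in> G"
    using i0 c0 Sc C_I_pos lam_pos[of i0] ge_one_powr_ge_zero[of 2 C_I]
    by (auto simp: G_def level_def quot_def divide_right_mono)
  moreover have finG: "finite G"
    by (simp add: G_def)
  ultimately have "Max G \<in> G"
    by (intro Max_in) auto
  define i where "i = Max G"
  have iG: "i \<in> G" and i_max: "\<And>i'. i' \<in> G \<Longrightarrow> i' \<le> i"
    using \<open>Max G \<in> G\<close> finG by (auto simp: i_def)
  have i: "i \<in> {1..N} - {j}" and act: "1 / lam i \<le> level j i" and cle: "card (chan j i) \<le> card S"
    using iG by (auto simp: G_def)
  define \<nu> where "\<nu> = level j i"
  have nu: "0 < \<nu>"
    using level_pos[OF i] by (simp add: \<nu>_def)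
  define h where "h l = rate_excess (\<nu> * lam l)" for l
  \<comment> \<open>Exchange with threshold \<open>h i\<close> if the sets are equally large, as
    \<open>h\<close> does not increase along the indices; otherwise with threshold 0, as channels of
    \<open>S\<close> outside \<open>chan j i\<close> have no excess.\<close>
  have "sum h S \<le> sum h (chan j i)"
  proof (cases "card (chan j i) = card S")
    case True
    have "h i \<le> h l" if "l \<in> chan j i" for l
      using that i nu lam_antimono[of l i] unfolding h_def
      by (intro rate_excess_mono mult_left_mono) (auto simp: chan_def)
    moreover have "h l \<le> h i" if "l \<in> S - chan j i" for l
      using that i S nu lam_antimono[of i l] unfolding h_def
      by (intro rate_excess_mono mult_left_mono) (auto simp: chan_def)
    ultimately show ?thesis
      using sum_exchange[of S "chan j i" "h i" h] finS True by simp
  next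
    case False
    have "h l \<le> 0" if l: "l \<in> S - chan j i" for l
    proof -
      have l': "l \<in> {1..N} - {j}" "i < l"
        using S l by (auto simp: chan_def)
      have "level j i * lam l < 1"
      proof (rule next_inactive[OF i l'])
        fix i' assume i': "i' \<in> {1..N} - {j}" and c: "card (chan j i') = Suc (card (chan j i))"
        have "i < i'"
        proof (rule ccontr)
          assume "\<not> i < i'"
          then have "chan j i' \<subseteq> chan j i"
            by (auto simp: chan_def)
          then show False
            using c card_mono[of "chan j i" "chan j i'"] by simp
        qed
        \<comment> \<open>\<open>i\<close> is the maximum of \<open>G\<close>, and \<open>i'\<close>
          meets the size bound because \<open>card (chan j i) < card S\<close>; hence it is activity
          that fails.\<close>
        then have "i' \<notin> G"
          using i_max by force
        then show "level j i' < 1 / lam i'"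
          using i' c cle False by (auto simp: G_def)
      qed
      then show ?thesis
        by (simp add: h_def \<nu>_def rate_excess_def)
    qed
    then show ?thesis
      using sum_exchange[of S "chan j i" 0 h] finS by (simp add: h_def rate_excess_nonneg)
  qed
  \<comment> \<open>The tangent bounds are summed over \<open>S\<close> and their excess moved to
    \<open>chan j i\<close>, where \<open>sum_ln_level\<close> produces \<open>C_I * ln 2\<close>
    again; it cancels, leaving a linear inequality.\<close>
  have "C_I * ln 2 \<le> (\<Sum>l\<in>S. ln (1 + x l * lam l))"
    using rate by (simp add: log_def sum_divide_distrib[symmetric] pos_le_divide_eq)
  also have "\<dots> \<le> (\<Sum>l\<in>S. h l + x l / \<nu>)"
    unfolding h_def using S x lam_pos nu by (intro sum_mono rate_tangent) auto
  also have "\<dots> = sum h S + sum x S / \<nu>"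
    by (simp add: sum.distrib sum_divide_distrib)
  also have "\<dots> \<le> sum h (chan j i) + sum x S / \<nu>"
    using \<open>sum h S \<le> sum h (chan j i)\<close> by simp
  also have "sum h (chan j i) = (\<Sum>l\<in>chan j i. ln (\<nu> * lam l) + (1 / lam l) / \<nu> - 1)"
    using level_active(2)[OF i act] by (intro sum.cong) (auto simp: h_def rate_excess_def \<nu>_def mult.commute)
  also have "\<dots> = C_I * ln 2 + (\<Sum>l\<in>chan j i. 1 / lam l) / \<nu> - real (card (chan j i))"
    using sum_ln_level[OF i] by (simp only: sum.distrib sum_subtractf sum_divide_distrib \<nu>_def) simp
  finally have "real (card (chan j i)) \<le> (\<Sum>l\<in>chan j i. 1 / lam l) / \<nu> + sum x S / \<nu>"
    by linarith
  then have "real (card (chan j i)) \<le> ((\<Sum>l\<in>chan j i. 1 / lam l) + sum x S) / \<nu>"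
    by (simp add: add_divide_distrib)
  then have "real (card (chan j i)) * \<nu> \<le> (\<Sum>l\<in>chan j i. 1 / lam l) + sum x S"
    using nu by (simp add: pos_le_divide_eq)
  then show ?thesis
    using i act cle by (intro bexI[of _ i]) (auto simp: demand_def \<nu>_def)
qed

text \<open>The demand is a sum of nonnegative terms \<open>level j i - 1 / lam l\<close>; if it
  were 0, all would vanish and the rate at this level would be 0 instead of
  \<open>C_I\<close>.\<close>

lemma demand_pos:
  assumes i: "i \<in> {1..N} - {j}" and act: "1 / lam i \<le> level j i"
  shows "0 < demand j i"
proof (rule ccontr)
  assume neg: "\<not> 0 < demand j i"
  have eq: "demand j i = (\<Sum>l\<in>chan j i. level j i - 1 / lam l)"
    by (simp add: demand_def sum_subtractf)
  have nn: "\<And>l. l \<in> chan j i \<Longrightarrow> 0 \<le> level j i - 1 / lam l"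
    using level_active(1)[OF i act] by simp
  then have "demand j i = 0"
    using neg sum_nonneg[of "chan j i" "\<lambda>l. level j i - 1 / lam l"] eq by simp
  then have "\<forall>l\<in>chan j i. level j i = 1 / lam l"
    using eq nn by (simp add: sum_nonneg_eq_0_iff)
  then have "\<forall>l\<in>chan j i. level j i * lam l = 1"
    using lam_pos i by (fastforce simp: chan_def)
  then have "(\<Sum>l\<in>chan j i. ln (level j i * lam l)) = 0"
    by simp
  then show False
    using sum_ln_level[OF i] C_I_pos by simp
qed

section \<open>Least total power of a pair and reduction to candidates\<close>

lemma card_chan_le: "j \<in> {1..N} \<Longrightarrow> i \<le> N \<Longrightarrow> card (chan j i) < N"
  using psubset_card_mono[of "{1..N}" "chan j i"] by (force simp: chan_def)

lemma denominators_pos: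
  assumes "(j, i) \<in> candidates"
  shows "0 < 1 - s * demand j i"
    and "0 < 1 - s * demand j i + (real N - real (card (chan j i))) * s / lam j"
proof -
  have "0 \<le> (real N - real (card (chan j i))) * s / lam j"
    using assms card_chan_le[of j i] s_nonneg lam_pos[of j] by (auto simp: candidates_def)
  then show "0 < 1 - s * demand j i"
    and "0 < 1 - s * demand j i + (real N - real (card (chan j i))) * s / lam j"
    using assms by (auto simp: candidates_def)
qed

text \<open>Positive denominators can be cleared; \<open>min_power j i\<close> is thus the least
  total power meeting the two linear constraints of the pair.\<close>

lemma min_power_le_iff:
  assumes "(j, i) \<in> candidates"
  shows "min_power j i \<le> P \<longleftrightarrow> (1 + s * P) * demand j i \<le> P \<and>
    (1 + s * P) * demand j i + (C_EH - (real N - real (card (chan j i))) * s * P) / lam j \<le> P"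
proof -
  define w where "w = (real N - real (card (chan j i))) * s"
  have "demand j i / (1 - s * demand j i) \<le> P \<longleftrightarrow> (1 + s * P) * demand j i \<le> P"
    using denominators_pos(1)[OF assms] by (simp add: pos_divide_le_eq algebra_simps)
  moreover have "(demand j i + C_EH / lam j) / (1 - s * demand j i + w / lam j) \<le> P \<longleftrightarrow>
      demand j i + C_EH / lam j \<le> P * (1 - s * demand j i + w / lam j)"
    using denominators_pos(2)[OF assms] by (simp add: pos_divide_le_eq w_def)
  moreover have "demand j i + C_EH / lam j \<le> P * (1 - s * demand j i + w / lam j) \<longleftrightarrow>
      (1 + s * P) * demand j i + (C_EH - w * P) / lam j \<le> P"
    by (simp add: algebra_simps diff_divide_distrib)
  ultimately show ?thesis
    by (simp add: min_power_def w_def)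
qed

text \<open>Let \<open>j\<close> be a strongest harvesting channel and give it all harvesting power;
  replace the information powers, in units of the noise \<open>B\<close>, by
  \<open>water_filling_bound\<close>. The information channels then need no more power and are no
  more numerous.\<close>

lemma feasible_candidate:
  assumes "feasible N lam s C_I C_EH p q"
  shows "\<exists>(j, i)\<in>candidates. min_power j i \<le> total_power N p"
proof -
  define P where "P = total_power N p"
  define B where "B = 1 + s * P"
  have rate: "C_I \<le> (\<Sum>i = 1..N. log 2 (1 + q i * p i * lam i / B))"
    and harvest: "C_EH \<le> (\<Sum>i = 1..N. (1 - q i) * (p i * lam i + s * P))"
    and p: "\<And>i. i \<in> {1..N} \<Longrightarrow> 0 \<le> p i" and q: "\<And>i. i \<in> {1..N} \<Longrightarrow> q i \<in> {0, 1}"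
    using assms by (auto simp: feasible_def P_def B_def)
  define S where "S = {i \<in> {1..N}. q i = 1}"
  define E where "E = {1..N} - S"
  have SE: "S \<subseteq> {1..N}" "E \<subseteq> {1..N}" "{1..N} = S \<union> E" "S \<inter> E = {}" "finite S" "finite E"
    by (auto simp: S_def E_def)
  have qE: "\<And>i. i \<in> E \<Longrightarrow> q i = 0" and qS: "\<And>i. i \<in> S \<Longrightarrow> q i = 1"
    using q by (auto simp: E_def S_def)
  have P0: "0 \<le> P"
    using p by (auto simp: P_def total_power_def intro: sum_nonneg)
  then have B: "1 \<le> B"
    using s_nonneg by (simp add: B_def)
  have sum_split: "(\<Sum>i = 1..N. f i) = sum f S + sum f E" for f :: "nat \<Rightarrow> real"
    unfolding SE(3) using SE(4-6) by (simp add: sum.union_disjoint)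
  have rateS: "C_I \<le> (\<Sum>l\<in>S. log 2 (1 + p l / B * lam l))"
    using rate qE qS by (simp add: sum_split del: One_nat_def)
  have harvestE: "C_EH \<le> (\<Sum>l\<in>E. p l * lam l) + card E * (s * P)"
    using harvest qE qS by (simp add: sum_split sum.distrib del: One_nat_def)
  have "E \<noteq> {}"
    using harvestE C_EH_pos by auto
  \<comment> \<open>Gains do not increase with the index, so the least index is a strongest channel
    of \<open>E\<close>.\<close>
  define j where "j = Min E"
  have jE: "j \<in> E" and j_min: "\<And>l. l \<in> E \<Longrightarrow> j \<le> l"
    using \<open>E \<noteq> {}\<close> SE by (auto simp: j_def)
  have jN: "j \<in> {1..N}"
    using jE SE by blast
  have "S \<subseteq> {1..N} - {j}"
    using jE SE by blast
  moreover have "\<And>l. l \<in> S \<Longrightarrow> 0 \<le> p l / B"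
    using p subsetD[OF SE(1)] B by (intro divide_nonneg_pos) auto
  ultimately obtain i where i: "i \<in> {1..N} - {j}" and act: "1 / lam i \<le> level j i"
    and c: "card (chan j i) \<le> card S" and dem: "demand j i \<le> (\<Sum>l\<in>S. p l / B)"
    using water_filling_bound[of S j "\<lambda>l. p l / B"] rateS by blast
  have "B * demand j i \<le> B * (\<Sum>l\<in>S. p l / B)"
    using dem B by (intro mult_left_mono) auto
  also have "\<dots> = sum p S"
    using B by (simp add: sum_divide_distrib[symmetric])
  finally have SB: "B * demand j i \<le> sum p S" .
  have P_split: "P = sum p S + sum p E"
    by (simp add: P_def total_power_def sum_split del: One_nat_def)
  have E0: "0 \<le> sum p E"
    using p SE by (intro sum_nonneg) auto
  have one: "(1 + s * P) * demand j i \<le> P"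
    using SB E0 P_split by (simp add: B_def)
  have dpos: "0 < demand j i"
    using demand_pos[OF i act] .
  \<comment> \<open>The gap is at least \<open>demand j i > 0\<close>. As \<open>P \<ge> 0\<close>,
    this rules out \<open>s * demand j i \<ge> 1\<close>.\<close>
  then have "P * (s * demand j i) < P"
    using one by (simp add: algebra_simps)
  then have "s * demand j i < 1"
    using mult_left_mono[of 1 "s * demand j i" P] P0 by linarith
  then have cand: "(j, i) \<in> candidates"
    using jN i act by (simp add: candidates_def)
  have lj: "0 < lam j"
    using jN by (rule lam_pos)
  have "(\<Sum>l\<in>E. p l * lam l) \<le> (\<Sum>l\<in>E. p l * lam j)"
  proof (intro sum_mono mult_left_mono)
    fix l assume "l \<in> E"
    then show "lam l \<le> lam j" "0 \<le> p l"
      using p subsetD[OF SE(2)] j_min jN lam_antimono by auto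
  qed
  also have "\<dots> = sum p E * lam j"
    by (simp add: sum_distrib_right)
  finally have "C_EH \<le> sum p E * lam j + card E * (s * P)"
    using harvestE by linarith
  moreover have "N = card S + card E"
    using card_Un_disjoint[of S E] SE(4-6) unfolding SE(3)[symmetric] by simp
  \<comment> \<open>\<open>chan j i\<close> is no larger than \<open>S\<close>, so at least as many
    channels contribute \<open>s * P\<close> as before.\<close>
  then have "real (card E) * (s * P) \<le> (real N - real (card (chan j i))) * (s * P)"
    using c s_nonneg P0 by (intro mult_right_mono) auto
  ultimately have "C_EH - (real N - real (card (chan j i))) * s * P \<le> sum p E * lam j"
    by (simp add: mult.assoc)
  then have "(C_EH - (real N - real (card (chan j i))) * s * P) / lam j \<le> sum p E"
    using lj by (simp add: pos_divide_le_eq)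
  then have "min_power j i \<le> P"
    using min_power_le_iff[OF cand] one SB P_split by (simp add: B_def)
  then show ?thesis
    using cand by (auto simp: P_def)
qed

section \<open>Feasible points attaining the least power, and optimality\<close>

definition sol_p :: "nat \<Rightarrow> nat \<Rightarrow> nat \<Rightarrow> real" where
  "sol_p j i l =
     (if l = j then min_power j i - (1 + s * min_power j i) * demand j i
      else if l \<in> {1..i} then (1 + s * min_power j i) * (level j i - 1 / lam l) else 0)"

text \<open>Channels beyond \<open>i\<close> carry no information and count as harvesting, which
  gains their \<open>s * P\<close> terms.\<close>

definition sol_q :: "nat \<Rightarrow> nat \<Rightarrow> nat \<Rightarrow> real" where
  "sol_q j i l = (if l \<in> chan j i then 1 else 0)"

text \<open>At \<open>P = min_power j i\<close> both inequalities of \<open>min_power_le_iff\<close>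
  hold: the first makes the power of \<open>j\<close> nonnegative, the second is the harvesting
  constraint. The rate constraint holds with equality by \<open>sum_ln_level\<close>.\<close>

lemma candidate_feasible:
  assumes cand: "(j, i) \<in> candidates"
  shows "total_power N (sol_p j i) = min_power j i"
    and "feasible N lam s C_I C_EH (sol_p j i) (sol_q j i)"
proof -
  define P where "P = min_power j i"
  define B where "B = 1 + s * P"
  define T where "T = chan j i"
  have i: "i \<in> {1..N} - {j}" and act: "1 / lam i \<le> level j i" and j: "j \<in> {1..N}"
    using cand by (auto simp: candidates_def)
  have one: "B * demand j i \<le> P" and
    two: "B * demand j i + (C_EH - (real N - real (card T)) * s * P) / lam j \<le> P"
    using min_power_le_iff[OF cand, of P] by (auto simp: P_def B_def T_def)
  have "0 < demand j i / (1 - s * demand j i)"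
    using denominators_pos(1)[OF cand] demand_pos[OF i act] by simp
  then have P0: "0 < P"
    by (simp add: P_def min_power_def less_max_iff_disj)
  have B: "1 \<le> B"
    using P0 s_nonneg by (simp add: B_def)
  define R where "R = {1..N} - insert j T"
  have sets: "{1..N} = insert j (T \<union> R)" "j \<notin> T \<union> R" "T \<inter> R = {}" "finite T" "finite R"
    "T \<subseteq> {1..N}" "R \<subseteq> {1..N}"
    using i j by (auto simp: R_def T_def chan_def)
  have sum_split: "(\<Sum>l = 1..N. f l) = f j + sum f T + sum f R" for f :: "nat \<Rightarrow> real"
    unfolding sets(1) using sets(2-5) by (simp add: sum.union_disjoint)
  have pj: "sol_p j i j = P - B * demand j i"
    by (simp add: sol_p_def P_def B_def)
  have pT: "sol_p j i l = B * (level j i - 1 / lam l)" if "l \<in> T" for l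
    using that by (auto simp: sol_p_def P_def B_def T_def chan_def)
  have pR: "sol_p j i l = 0" if "l \<in> R" for l
    using that by (auto simp: sol_p_def R_def T_def chan_def)
  have qj: "sol_q j i j = 0"
    by (simp add: sol_q_def chan_def)
  have qT: "sol_q j i l = 1" if "l \<in> T" for l
    using that by (simp add: sol_q_def T_def)
  have qR: "sol_q j i l = 0" if "l \<in> R" for l
    using that by (simp add: sol_q_def R_def T_def)
  have "sum (sol_p j i) T = B * demand j i"
    by (simp add: pT demand_def sum_subtractf T_def[symmetric] sum_distrib_left[symmetric])
  then have total: "total_power N (sol_p j i) = P"
    by (simp add: total_power_def sum_split pj pR del: One_nat_def)
  then show "total_power N (sol_p j i) = min_power j i"
    by (simp add: P_def)
  have "(\<Sum>l = 1..N. log 2 (1 + sol_q j i l * sol_p j i l * lam l / (1 + s * P))) =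
        (\<Sum>l\<in>T. log 2 (level j i * lam l))"
  proof -
    have "1 + sol_q j i l * sol_p j i l * lam l / (1 + s * P) = level j i * lam l" if "l \<in> T" for l
    proof -
      have "0 < lam l" using that sets lam_pos by blast
      then show ?thesis
        using that B by (simp add: qT pT B_def[symmetric] left_diff_distrib)
    qed
    then show ?thesis
      by (simp add: sum_split qj qR del: One_nat_def)
  qed
  also have "\<dots> = (\<Sum>l\<in>T. ln (level j i * lam l)) / ln 2"
    by (simp add: log_def sum_divide_distrib)
  also have "\<dots> = C_I"
    using sum_ln_level[OF i] by (simp add: T_def)
  finally have rate: "(\<Sum>l = 1..N. log 2 (1 + sol_q j i l * sol_p j i l * lam l / (1 + s * P))) = C_I" .
  have "card {1..N} = Suc (card T + card R)"
    unfolding sets(1) using sets(2-5) by (simp add: card_Un_disjoint)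
  \<comment> \<open>\<open>j\<close> is the one harvesting channel outside \<open>R\<close>.\<close>
  then have cR: "real (card R) = real N - real (card T) - 1"
    by simp
  have lj: "0 < lam j"
    using j by (rule lam_pos)
  have "(\<Sum>l = 1..N. (1 - sol_q j i l) * (sol_p j i l * lam l + s * P)) =
     (P - B * demand j i) * lam j + s * P + real (card R) * (s * P)"
    by (simp add: sum_split qj qT qR pR pj del: One_nat_def)
  also have "\<dots> = (P - B * demand j i) * lam j + (real N - real (card T)) * s * P"
    unfolding cR by (simp add: left_diff_distrib)
  also have "\<dots> \<ge> C_EH"
  proof -
    have "(C_EH - (real N - real (card T)) * s * P) / lam j \<le> P - B * demand j i"
      using two by linarith
    then show ?thesis
      using lj by (simp add: pos_divide_le_eq)
  qed
  finally have harvest: "C_EH \<le> (\<Sum>l = 1..N. (1 - sol_q j i l) * (sol_p j i l * lam l + s * P))" .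
  have nonneg: "0 \<le> sol_p j i l" if l: "l \<in> {1..N}" for l
  proof -
    consider "l = j" | "l \<in> T" | "l \<in> R"
      using l unfolding sets(1) by blast
    then show ?thesis
    proof cases
      case 2
      then show ?thesis
        using level_active(1)[OF i act, of l] B by (simp add: pT T_def)
    qed (simp_all add: pj pR one)
  qed
  show "feasible N lam s C_I C_EH (sol_p j i) (sol_q j i)"
    unfolding feasible_def total
  proof (intro conjI)
    show "C_I \<le> (\<Sum>l = 1..N. log 2 (1 + sol_q j i l * sol_p j i l * lam l / (1 + s * P)))"
      by (rule eq_refl[OF rate[symmetric]])
    show "C_EH \<le> (\<Sum>l = 1..N. (1 - sol_q j i l) * (sol_p j i l * lam l + s * P))"
      by (rule harvest)
    show "\<forall>l\<in>{1..N}. 0 \<le> sol_p j i l \<and> sol_q j i l \<in> {0, 1}"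
    proof
      fix l assume "l \<in> {1..N}"
      then show "0 \<le> sol_p j i l \<and> sol_q j i l \<in> {0, 1}"
        by (intro conjI nonneg) (simp_all add: sol_q_def)
    qed
  qed
qed

lemma optimal_candidate:
  assumes "(j, i) \<in> candidates" and "\<And>j' i'. (j', i') \<in> candidates \<Longrightarrow> min_power j i \<le> min_power j' i'"
  shows "optimal N lam s C_I C_EH (sol_p j i) (sol_q j i)"
proof -
  have "total_power N (sol_p j i) \<le> total_power N p"
    if feas: "feasible N lam s C_I C_EH p q" for p q
  proof -
    obtain j' i' where "(j', i') \<in> candidates" "min_power j' i' \<le> total_power N p"
      using feas feasible_candidate by blast
    then show ?thesis
      using assms(2)[of j' i'] candidate_feasible(1)[OF assms(1)] by linarith
  qed
  then show ?thesis
    unfolding optimal_def is_arg_min_linorder using candidate_feasible(2)[OF assms(1)] by auto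
qed

lemma no_candidate_infeasible:
  "candidates = {} \<Longrightarrow> \<nexists>p q. feasible N lam s C_I C_EH p q"
  using feasible_candidate by blast

end


section \<open>Total correctness with running times\<close>

text \<open>Evaluator by which the simplifier executes loop-free code; loops give
  \<open>None\<close> and are left to \<open>ht_Loop\<close>.\<close>

fun run :: "nat \<Rightarrow> prog \<Rightarrow> state \<Rightarrow> state option" where
  "run N Skip st = Some st"
| "run N (Do a) st = step N a st"
| "run N (c ;; d) st = Option.bind (run N c st) (run N d)"
| "run N (Cond b c d) st = (if holds b st then run N c st else run N d st)"
| "run N (Loop b c) st = None"

text \<open>A conditional is charged for its dearer branch, so this bounds the running time of
  loop-free code from above.\<close>

fun cost :: "prog \<Rightarrow> nat" where
  "cost Skip = 0"
| "cost (Do a) = 1"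
| "cost (c ;; d) = cost c + cost d"
| "cost (Cond b c d) = 1 + max (cost c) (cost d)"
| "cost (Loop b c) = 1"

lemma exec_run: "run N c st = Some st' \<Longrightarrow> \<exists>t\<le>cost c. exec N c st t st'"
proof (induction c arbitrary: st st')
  case Skip
  then show ?case
    using exec.Skip by force
next
  case (Do a)
  then show ?case
    using exec.Do by force
next
  case (Seq c d)
  then obtain st1 where "run N c st = Some st1" "run N d st1 = Some st'"
    by (auto simp: bind_eq_Some_conv)
  with Seq.IH obtain t u where "t \<le> cost c" "exec N c st t st1" "u \<le> cost d" "exec N d st1 u st'"
    by meson
  then show ?case
    by (metis exec.Seq cost.simps(3) add_mono)
next
  case (Cond b c d)
  show ?case
  proof (cases "holds b st")
    case True
    with Cond obtain t where "t \<le> cost c" "exec N c st t st'" by fastforce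
    then show ?thesis
      using exec.CondTrue[OF True] by (intro exI[of _ "1 + t"]) simp
  next
    case False
    with Cond obtain t where "t \<le> cost d" "exec N d st t st'" by fastforce
    then show ?thesis
      using exec.CondFalse[OF False] by (intro exI[of _ "1 + t"]) simp
  qed
qed simp

text \<open>Hoare triple for total correctness, with \<open>t\<close> an upper bound on the running
  time.\<close>

definition ht :: "nat \<Rightarrow> (state \<Rightarrow> bool) \<Rightarrow> prog \<Rightarrow> nat \<Rightarrow> (state \<Rightarrow> bool) \<Rightarrow> bool" where
  "ht N P c t Q \<longleftrightarrow> (\<forall>st. P st \<longrightarrow> (\<exists>u\<le>t. \<exists>st'. exec N c st u st' \<and> Q st'))"

lemma ht_run:
  assumes "\<And>st. P st \<Longrightarrow> \<exists>st'. run N c st = Some st' \<and> Q st'"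
  shows "ht N P c (cost c) Q"
  unfolding ht_def using assms exec_run by meson

lemma ht_Seq:
  assumes "ht N P c t Q" "ht N Q d u R"
  shows "ht N P (c ;; d) (t + u) R"
  unfolding ht_def
proof (intro allI impI)
  fix st assume "P st"
  then obtain v st1 where "v \<le> t" "exec N c st v st1" "Q st1"
    using assms(1) unfolding ht_def by blast
  moreover then obtain w st2 where "w \<le> u" "exec N d st1 w st2" "R st2"
    using assms(2) unfolding ht_def by blast
  ultimately show "\<exists>v\<le>t + u. \<exists>st'. exec N (c ;; d) st v st' \<and> R st'"
    by (intro exI[of _ "v + w"] conjI exI[of _ st2] exec.Seq) auto
qed

lemma ht_weaken:
  assumes "ht N P c t Q" "\<And>st. P' st \<Longrightarrow> P st" "\<And>st. Q st \<Longrightarrow> Q' st" "t \<le> t'"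
  shows "ht N P' c t' Q'"
  using assms unfolding ht_def by (meson order_trans)

lemma ht_Cond:
  assumes "ht N (\<lambda>st. P st \<and> holds b st) c t Q" "ht N (\<lambda>st. P st \<and> \<not> holds b st) d t Q"
  shows "ht N P (Cond b c d) (1 + t) Q"
  unfolding ht_def
proof (intro allI impI)
  fix st assume P: "P st"
  show "\<exists>u\<le>1 + t. \<exists>st'. exec N (Cond b c d) st u st' \<and> Q st'"
  proof (cases "holds b st")
    case True
    then obtain u st' where u: "u \<le> t" "exec N c st u st'" "Q st'"
      using assms(1) P unfolding ht_def by blast
    show ?thesis
      using exec.CondTrue[OF True u(2)] u(1,3)
      by (intro exI[of _ "1 + u"] conjI exI[of _ st']) auto
  next
    case False
    then obtain u st' where u: "u \<le> t" "exec N d st u st'" "Q st'"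
      using assms(2) P unfolding ht_def by blast
    show ?thesis
      using exec.CondFalse[OF False u(2)] u(1,3)
      by (intro exI[of _ "1 + u"] conjI exI[of _ st']) auto
  qed
qed

text \<open>\<open>I m\<close> describes the state after \<open>m\<close> of exactly
  \<open>n\<close> iterations. Each pays 1 for its test; the final failing test is the last
  1.\<close>

lemma ht_Loop:
  assumes body: "\<And>m. m < n \<Longrightarrow> ht N (I m) c t (I (Suc m))"
    and enter: "\<And>m st. m < n \<Longrightarrow> I m st \<Longrightarrow> holds b st"
    and leave: "\<And>st. I n st \<Longrightarrow> \<not> holds b st"
  shows "ht N (I 0) (Loop b c) (n * (t + 1) + 1) (I n)"
proof -
  \<comment> \<open>Generalised to a loop with \<open>m\<close> iterations already done; the
    induction descends from \<open>m = n\<close>.\<close>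
  have "ht N (I m) (Loop b c) ((n - m) * (t + 1) + 1) (I n)" if "m \<le> n" for m
    using that
  proof (induction rule: inc_induct)
    case base
    show ?case
      unfolding ht_def using leave exec.LoopFalse by fastforce
  next
    case (step m)
    show ?case
      unfolding ht_def
    proof (intro allI impI)
      fix st assume I: "I m st"
      then obtain u st1 where 1: "u \<le> t" "exec N c st u st1" "I (Suc m) st1"
        using body step.hyps unfolding ht_def by blast
      then obtain v st2 where 2: "v \<le> (n - Suc m) * (t + 1) + 1" "exec N (Loop b c) st1 v st2" "I n st2"
        using step.IH unfolding ht_def by blast
      have "n - m = Suc (n - Suc m)"
        using step.hyps by simp
      then have "1 + u + v \<le> (n - m) * (t + 1) + 1"
        using 1 2 by simp
      then show "\<exists>u\<le>(n - m) * (t + 1) + 1. \<exists>st'. exec N (Loop b c) st u st' \<and> I n st'"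
        using exec.LoopTrue[OF enter[OF _ I] 1(2) 2(2)] step.hyps 2(3) by blast
    qed
  qed
  from this[of 0] show ?thesis by simp
qed


section \<open>The program\<close>

text \<open>No instruction turns a natural number into a real one, so \<open>N\<close> is counted up
  in the real register \<open>Nr\<close>.\<close>

definition count_channels :: prog where
  "count_channels =
     Do (RConst ''one'' 1) ;; Do (Arith Add ''Nr'' ''Nr'' ''one'') ;; Do (IInc ''i'')"

text \<open>The number of channels is kept twice, in \<open>k\<close> as root degree and in
  \<open>kr\<close> as real factor; \<open>quot\<close> starts with the empty product of
  gains.\<close>

definition start_row :: prog where
  "start_row =
     Do (IConst ''i'' 1) ;; Do (IConst ''k'' 0) ;; Do (RConst ''kr'' 0) ;;
     Do (Exp2 ''quot'' ''C_I'') ;; Do (RConst ''sum'' 0)"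

text \<open>Constant time per added channel. \<open>d\<close> becomes
  \<open>1 - s * demand j i\<close>, which serves both to test the pair and as a
  denominator.\<close>

definition extend :: prog where
  "extend =
     Do (RConst ''one'' 1) ;; Do (Load ''x'' ''lambda'' ''i'') ;;
     Do (Arith Div ''inv'' ''one'' ''x'') ;; Do (Arith Div ''quot'' ''quot'' ''x'') ;;
     Do (Arith Add ''sum'' ''sum'' ''inv'') ;;
     Do (IInc ''k'') ;; Do (Arith Add ''kr'' ''kr'' ''one'') ;;
     Do (Root ''nu'' ''k'' ''quot'') ;;
     Do (Arith Mul ''A'' ''kr'' ''nu'') ;; Do (Arith Sub ''A'' ''A'' ''sum'') ;;
     Do (Arith Mul ''d'' ''sigma2'' ''A'') ;; Do (Arith Sub ''d'' ''one'' ''d'')"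

definition compute_power :: prog where
  "compute_power =
     Do (Load ''y'' ''lambda'' ''j'') ;;
     Do (Arith Div ''Q'' ''A'' ''d'') ;;
     Do (Arith Div ''u'' ''C_EH'' ''y'') ;; Do (Arith Add ''u'' ''A'' ''u'') ;;
     Do (Arith Sub ''w'' ''Nr'' ''kr'') ;; Do (Arith Mul ''w'' ''w'' ''sigma2'') ;;
     Do (Arith Div ''w'' ''w'' ''y'') ;; Do (Arith Add ''w'' ''d'' ''w'') ;;
     Do (Arith Div ''u'' ''u'' ''w'') ;;
     Cond (RLe ''Q'' ''u'') (Do (RCopy ''Q'' ''u'')) Skip"

text \<open>Level and demand are saved with the pair so that each output cell can later be computed
  in constant time.\<close>

definition record_best :: prog where
  "record_best =
     Do (IConst ''status'' 1) ;; Do (ICopy ''bj'' ''j'') ;; Do (ICopy ''bi'' ''i'') ;;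
     Do (RCopy ''best'' ''Q'') ;; Do (RCopy ''bnu'' ''nu'') ;; Do (RCopy ''bA'' ''A'')"

definition update_best :: prog where
  "update_best =
     Do (IConst ''zero'' 0) ;;
     Cond (IEq ''status'' ''zero'') record_best (Cond (RLess ''Q'' ''best'') record_best Skip)"

text \<open>The tests are the two numerical conditions of \<open>candidates\<close> and guard the
  divisions by \<open>d\<close> and \<open>w\<close>. The real register \<open>zero\<close> is
  distinct from the natural-number register of that name.\<close>

definition try_candidate :: prog where
  "try_candidate =
     Do (RConst ''zero'' 0) ;;
     Cond (RLe ''inv'' ''nu'')
       (Cond (RLess ''zero'' ''d'') (compute_power ;; update_best) Skip) Skip"

definition search_step :: prog where
  "search_step = Cond (IEq ''i'' ''j'') Skip (extend ;; try_candidate)"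

definition search_row :: prog where
  "search_row =
     start_row ;; Loop (ILe ''i'' ''N'') (search_step ;; Do (IInc ''i'')) ;; Do (IInc ''j'')"

text \<open>Both arrays are 0 beforehand, so the selector of \<open>bj\<close> and all other
  channels beyond \<open>bi\<close> are left as they are.\<close>

definition write_cell :: prog where
  "write_cell =
     Do (RConst ''one'' 1) ;; Do (Arith Mul ''B'' ''sigma2'' ''best'') ;;
     Do (Arith Add ''B'' ''one'' ''B'') ;;
     Cond (IEq ''i'' ''bj'')
       (Do (Arith Mul ''x'' ''B'' ''bA'') ;; Do (Arith Sub ''x'' ''best'' ''x'') ;;
        Do (Store ''P'' ''i'' ''x''))
       (Cond (ILe ''i'' ''bi'')
         (Do (Load ''x'' ''lambda'' ''i'') ;; Do (Arith Div ''x'' ''one'' ''x'') ;;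
          Do (Arith Sub ''x'' ''bnu'' ''x'') ;; Do (Arith Mul ''x'' ''B'' ''x'') ;;
          Do (Store ''P'' ''i'' ''x'') ;; Do (Store ''pi'' ''i'' ''one''))
         Skip) ;;
     Do (IInc ''i'')"

definition solver :: prog where
  "solver =
     (Do (IConst ''i'' 1) ;; Loop (ILe ''i'' ''N'') count_channels) ;;
     (Do (IConst ''j'' 1) ;; Loop (ILe ''j'' ''N'') search_row) ;;
     Do (IConst ''zero'' 0) ;;
     Cond (IEq ''status'' ''zero'') Skip (Do (IConst ''i'' 1) ;; Loop (ILe ''i'' ''N'') write_cell)"


section \<open>Correctness of the program\<close>

lemmas set_simps = set_ireg_def set_rreg_def set_rarr_def

context swipt
begin

section \<open>Invariants of the search\<close>

definition inputs :: "state \<Rightarrow> bool" where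
  "inputs st \<longleftrightarrow>
     ireg st ''N'' = N \<and> rreg st ''sigma2'' = s \<and> rreg st ''C_I'' = C_I \<and> rreg st ''C_EH'' = C_EH \<and>
     rarr st ''lambda'' = (\<lambda>i. if i \<in> {1..N} then lam i else 0)"

text \<open>\<open>D\<close> holds the pairs tried so far; intersecting it with
  \<open>candidates\<close> lets rejected pairs enter \<open>D\<close> without affecting the record.
  The zero arrays are kept for the output phase.\<close>

definition search_inv :: "(nat \<times> nat) set \<Rightarrow> state \<Rightarrow> bool" where
  "search_inv D st \<longleftrightarrow>
     inputs st \<and> rreg st ''Nr'' = real N \<and>
     rarr st ''P'' = (\<lambda>_. 0) \<and> rarr st ''pi'' = (\<lambda>_. 0) \<and>
     (ireg st ''status'' = 0 \<and> D \<inter> candidates = {} \<or>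
      ireg st ''status'' = 1 \<and> (ireg st ''bj'', ireg st ''bi'') \<in> candidates \<and>
      rreg st ''best'' = min_power (ireg st ''bj'') (ireg st ''bi'') \<and>
      rreg st ''bnu'' = level (ireg st ''bj'') (ireg st ''bi'') \<and>
      rreg st ''bA'' = demand (ireg st ''bj'') (ireg st ''bi'') \<and>
      (\<forall>j i. (j, i) \<in> D \<inter> candidates \<longrightarrow> rreg st ''best'' \<le> min_power j i))"

definition row_inv :: "nat \<Rightarrow> nat \<Rightarrow> state \<Rightarrow> bool" where
  "row_inv j m st \<longleftrightarrow>
     ireg st ''j'' = j \<and> ireg st ''k'' = card (chan j m) \<and>
     rreg st ''kr'' = real (card (chan j m)) \<and> rreg st ''quot'' = quot j m \<and>
     rreg st ''sum'' = (\<Sum>l\<in>chan j m. 1 / lam l)"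

definition extended_inv :: "nat \<Rightarrow> nat \<Rightarrow> state \<Rightarrow> bool" where
  "extended_inv j i st \<longleftrightarrow>
     row_inv j i st \<and> ireg st ''i'' = i \<and> rreg st ''inv'' = 1 / lam i \<and>
     rreg st ''nu'' = level j i \<and> rreg st ''A'' = demand j i \<and>
     rreg st ''d'' = 1 - s * demand j i"

definition visited :: "nat \<Rightarrow> nat \<Rightarrow> (nat \<times> nat) set" where
  "visited j i = {1..<j} \<times> {1..N} \<union> {j} \<times> {1..i}"

lemma chan_Suc:
  "chan j (Suc m) = (if Suc m = j then chan j m else insert (Suc m) (chan j m))"
  "Suc m \<notin> chan j m"
  by (auto simp: chan_def)

section \<open>Verification of one row of the search\<close>

lemma ht_start_row:
  "ht N (\<lambda>st. search_inv D st \<and> ireg st ''j'' = j) start_row (cost start_row)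
     (\<lambda>st. search_inv D st \<and> row_inv j 0 st \<and> ireg st ''i'' = 1)"
  by (rule ht_run)
    (simp add: start_row_def set_simps search_inv_def inputs_def row_inv_def chan_def quot_def)

lemma ht_extend:
  assumes "Suc m \<le> N" "Suc m \<noteq> j"
  shows "ht N (\<lambda>st. search_inv D st \<and> row_inv j m st \<and> ireg st ''i'' = Suc m) extend (cost extend)
     (\<lambda>st. search_inv D st \<and> extended_inv j (Suc m) st)"
proof (rule ht_run)
  fix st assume st: "search_inv D st \<and> row_inv j m st \<and> ireg st ''i'' = Suc m"
  have l: "0 < lam (Suc m)"
    using assms lam_pos by simp
  have c: "card (chan j (Suc m)) = Suc (card (chan j m))" "quot j (Suc m) = quot j m / lam (Suc m)"
    "(\<Sum>l\<in>chan j (Suc m). 1 / lam l) = (\<Sum>l\<in>chan j m. 1 / lam l) + 1 / lam (Suc m)"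
    using assms chan_Suc(2)[of m j] by (simp_all add: chan_Suc(1) quot_def)
  \<comment> \<open>\<open>Root\<close> is defined only for degrees up to \<open>N\<close> and
    positive radicands.\<close>
  have "card (chan j (Suc m)) \<le> N"
    using card_mono[OF _ chan_subset[OF assms(1), of j]] by simp
  moreover have "0 < quot j (Suc m)"
    using quot_pos assms by simp
  ultimately show "\<exists>st'. run N extend st = Some st' \<and> search_inv D st' \<and> extended_inv j (Suc m) st'"
    using st l assms c
    by (simp add: extend_def set_simps search_inv_def inputs_def row_inv_def extended_inv_def
        level_def demand_def algebra_simps)
qed


lemma ht_compute_power:
  assumes "(j, i) \<in> candidates"
  shows "ht N (\<lambda>st. search_inv D st \<and> extended_inv j i st) compute_power (cost compute_power)
     (\<lambda>st. search_inv D st \<and> extended_inv j i st \<and> rreg st ''Q'' = min_power j i)"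
proof (rule ht_run)
  fix st assume st: "search_inv D st \<and> extended_inv j i st"
  have j: "1 \<le> j" "j \<le> N" and l: "0 < lam j"
    using assms lam_pos[of j] by (auto simp: candidates_def)
  have d: "1 - s * demand j i \<noteq> 0"
    "1 - s * demand j i + (real N - real (card (chan j i))) * s / lam j \<noteq> 0"
    using denominators_pos[OF assms] by linarith+
  show "\<exists>st'. run N compute_power st = Some st' \<and> search_inv D st' \<and> extended_inv j i st' \<and>
      rreg st' ''Q'' = min_power j i"
    using st j l d min_power_def[of j i, unfolded max_def]
    by (simp add: compute_power_def set_simps search_inv_def inputs_def row_inv_def extended_inv_def)
qed

lemma ht_update_best:
  assumes "(j, i) \<in> candidates"
  shows "ht N (\<lambda>st. search_inv D st \<and> extended_inv j i st \<and> rreg st ''Q'' = min_power j i)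
     update_best (cost update_best)
     (\<lambda>st. search_inv (insert (j, i) D) st \<and> extended_inv j i st)"
proof (rule ht_run)
  fix st assume st: "search_inv D st \<and> extended_inv j i st \<and> rreg st ''Q'' = min_power j i"
  show "\<exists>st'. run N update_best st = Some st' \<and> search_inv (insert (j, i) D) st' \<and> extended_inv j i st'"
  proof (cases "ireg st ''status'' = 0 \<or> min_power j i < rreg st ''best''")
    case True
    \<comment> \<open>With nothing recorded \<open>D\<close> contains no candidate; otherwise the
      new power lies below \<open>best\<close>, a lower bound over the candidates in
      \<open>D\<close>.\<close>
    then have "\<forall>j' i'. (j', i') \<in> insert (j, i) D \<inter> candidates \<longrightarrow> min_power j i \<le> min_power j' i'"
      using st by (force simp: search_inv_def)
    moreover have "run N update_best st = run N record_best (set_ireg ''zero'' 0 st)"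
      using True st by (auto simp: update_best_def set_simps)
    ultimately show ?thesis
      using st assms
      by (simp add: record_best_def set_simps search_inv_def inputs_def row_inv_def extended_inv_def)
  next
    case False
    then have "ireg st ''status'' = 1"
      and "\<forall>j' i'. (j', i') \<in> insert (j, i) D \<inter> candidates \<longrightarrow> rreg st ''best'' \<le> min_power j' i'"
      using st by (auto simp: search_inv_def)
    then show ?thesis
      using st assms False
      by (simp add: update_best_def record_best_def set_simps search_inv_def inputs_def
          row_inv_def extended_inv_def)
  qed
qed

lemma search_inv_insert: "(j, i) \<notin> candidates \<Longrightarrow> search_inv (insert (j, i) D) st = search_inv D st"
  by (auto simp: search_inv_def Int_insert_left)

text \<open>A pair failing a test is no candidate, so by \<open>search_inv_insert\<close> it may
  enter \<open>D\<close> with the record unchanged.\<close>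

lemma ht_try_candidate:
  assumes "j \<in> {1..N}" "i \<in> {1..N} - {j}"
  shows "ht N (\<lambda>st. search_inv D st \<and> extended_inv j i st) try_candidate
     (1 + (1 + (1 + (cost compute_power + cost update_best))))
     (\<lambda>st. search_inv (insert (j, i) D) st \<and> extended_inv j i st)"
proof -
  define K where "K st \<longleftrightarrow> search_inv D st \<and> extended_inv j i st" for st
  define K' where "K' st \<longleftrightarrow> search_inv (insert (j, i) D) st \<and> extended_inv j i st" for st
  have zero: "ht N K (Do (RConst ''zero'' 0)) 1 (\<lambda>st. K st \<and> rreg st ''zero'' = 0)"
    using ht_run[of K N "Do (RConst ''zero'' 0)" "\<lambda>st. K st \<and> rreg st ''zero'' = 0"]
    by (simp add: K_def set_simps search_inv_def inputs_def row_inv_def extended_inv_def)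
  have skip: "ht N P Skip t K'" if "\<And>st. P st \<Longrightarrow> K' st" for P t
    using that exec.Skip unfolding ht_def by blast
  \<comment> \<open>If the pair is no candidate, the precondition is unsatisfiable and the triple
    holds vacuously.\<close>
  have upd: "ht N P (compute_power ;; update_best) (cost compute_power + cost update_best) K'"
    if "\<And>st. P st \<Longrightarrow> K st \<and> (j, i) \<in> candidates" for P
  proof (cases "(j, i) \<in> candidates")
    case True
    show ?thesis
      by (rule ht_weaken[OF ht_Seq[OF ht_compute_power[OF True, of D] ht_update_best[OF True]]])
        (use that in \<open>auto simp: K_def K'_def\<close>)
  next
    case False
    then show ?thesis using that by (auto simp: ht_def)
  qed
  have "ht N K try_candidate
     (1 + (1 + (1 + (cost compute_power + cost update_best)))) K'"
    unfolding try_candidate_def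
    by (intro ht_Seq[OF zero] ht_Cond skip upd)
      (use assms in \<open>auto simp: K_def K'_def extended_inv_def candidates_def search_inv_insert\<close>)
  then show ?thesis
    by (simp add: K_def[abs_def] K'_def[abs_def])
qed

definition step_cost :: nat where
  "step_cost = 1 + (cost extend + (1 + (1 + (1 + (cost compute_power + cost update_best)))))"

lemma ht_search_step:
  assumes "j \<in> {1..N}" "Suc m \<le> N"
  shows "ht N (\<lambda>st. search_inv (visited j m) st \<and> row_inv j m st \<and> ireg st ''i'' = Suc m)
     (search_step ;; Do (IInc ''i'')) (step_cost + 1)
     (\<lambda>st. search_inv (visited j (Suc m)) st \<and> row_inv j (Suc m) st \<and> ireg st ''i'' = Suc (Suc m))"
    (is "ht N ?P _ _ ?Q")
proof (rule ht_Seq)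
  define R where
    "R st \<longleftrightarrow> search_inv (visited j (Suc m)) st \<and> row_inv j (Suc m) st \<and> ireg st ''i'' = Suc m" for st
  have v: "visited j (Suc m) = insert (j, Suc m) (visited j m)"
    by (auto simp: visited_def)
  show "ht N ?P search_step step_cost R"
    unfolding search_step_def step_cost_def
  proof (rule ht_Cond)
    show "ht N (\<lambda>st. ?P st \<and> holds (IEq ''i'' ''j'') st) Skip
        (cost extend + (1 + (1 + (1 + (cost compute_power + cost update_best))))) R"
    proof -
      have "R st" if "?P st" "holds (IEq ''i'' ''j'') st" for st
      proof -
        \<comment> \<open>At column \<open>j\<close> the channel set does not grow and the pair is
          no candidate, so skipping it counts as a visit.\<close>
        have "j = Suc m" using that by (simp add: row_inv_def)
        then have not_cand: "(j, Suc m) \<notin> candidates" and "chan j (Suc m) = chan j m"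
          by (simp_all add: candidates_def chan_Suc(1))
        then show ?thesis
          using that unfolding R_def v search_inv_insert[OF not_cand]
          by (simp add: row_inv_def quot_def)
      qed
      then show ?thesis
        using exec.Skip unfolding ht_def by blast
    qed
    show "ht N (\<lambda>st. ?P st \<and> \<not> holds (IEq ''i'' ''j'') st) (extend ;; try_candidate)
        (cost extend + (1 + (1 + (1 + (cost compute_power + cost update_best))))) R"
    proof (cases "j = Suc m")
      case True
      then show ?thesis by (auto simp: ht_def row_inv_def)
    next
      case False
      then have "Suc m \<noteq> j" "Suc m \<in> {1..N} - {j}"
        using assms by auto
      from ht_Seq[OF ht_extend[OF assms(2) this(1)] ht_try_candidate[OF assms(1) this(2)], of "visited j m"]
      show ?thesis
        by (rule ht_weaken) (auto simp: R_def v extended_inv_def)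
    qed
  qed
  show "ht N R (Do (IInc ''i'')) 1 ?Q"
    using ht_run[of R N "Do (IInc ''i'')" ?Q]
    by (simp add: R_def set_simps search_inv_def inputs_def row_inv_def)
qed

definition row_cost :: nat where
  "row_cost = cost start_row + (N * (step_cost + 1 + 1) + 1 + 1)"

lemma ht_search_row:
  assumes "m < N"
  shows "ht N (\<lambda>st. search_inv ({1..m} \<times> {1..N}) st \<and> ireg st ''j'' = Suc m) search_row row_cost
     (\<lambda>st. search_inv ({1..Suc m} \<times> {1..N}) st \<and> ireg st ''j'' = Suc (Suc m))"
    (is "ht N ?P _ _ ?Q")
proof -
  define I where
    "I k st \<longleftrightarrow> search_inv (visited (Suc m) k) st \<and> row_inv (Suc m) k st \<and> ireg st ''i'' = Suc k" for k st
  have v: "visited (Suc m) 0 = {1..m} \<times> {1..N}" "visited (Suc m) N = {1..Suc m} \<times> {1..N}"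
    by (auto simp: visited_def)
  have start: "ht N ?P start_row (cost start_row) (I 0)"
    by (rule ht_weaken[OF ht_start_row[of "{1..m} \<times> {1..N}" "Suc m"]])
      (simp_all add: I_def v del: One_nat_def)
  have loop: "ht N (I 0) (Loop (ILe ''i'' ''N'') (search_step ;; Do (IInc ''i'')))
      (N * (step_cost + 1 + 1) + 1) (I N)"
  proof (rule ht_Loop)
    show "ht N (I k) (search_step ;; Do (IInc ''i'')) (step_cost + 1) (I (Suc k))" if "k < N" for k
      unfolding I_def[abs_def] using that assms by (intro ht_search_step) auto
  qed (simp_all add: I_def search_inv_def inputs_def)
  have inc: "ht N (I N) (Do (IInc ''j'')) 1 ?Q"
    using ht_run[of "I N" N "Do (IInc ''j'')" ?Q]
    by (simp add: I_def v set_simps search_inv_def inputs_def row_inv_def del: One_nat_def)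
  show ?thesis
    unfolding search_row_def row_cost_def by (rule ht_Seq[OF start ht_Seq[OF loop inc]])
qed

section \<open>Initialisation and the whole search\<close>

definition prepare_inv :: "nat \<Rightarrow> state \<Rightarrow> bool" where
  "prepare_inv m st \<longleftrightarrow>
     inputs st \<and> rreg st ''Nr'' = real m \<and> ireg st ''i'' = Suc m \<and> ireg st ''status'' = 0 \<and>
     rarr st ''P'' = (\<lambda>_. 0) \<and> rarr st ''pi'' = (\<lambda>_. 0)"

lemma ht_prepare:
  "ht N (\<lambda>st. st = initial N lam s C_I C_EH)
     (Do (IConst ''i'' 1) ;; Loop (ILe ''i'' ''N'') count_channels)
     (1 + (N * (cost count_channels + 1) + 1)) (prepare_inv N)"
proof (rule ht_Seq)
  show "ht N (\<lambda>st. st = initial N lam s C_I C_EH) (Do (IConst ''i'' 1)) 1 (prepare_inv 0)"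
    using ht_run[of "\<lambda>st. st = initial N lam s C_I C_EH" N "Do (IConst ''i'' 1)" "prepare_inv 0"]
    by (simp add: set_simps prepare_inv_def inputs_def initial_def)
  show "ht N (prepare_inv 0) (Loop (ILe ''i'' ''N'') count_channels)
      (N * (cost count_channels + 1) + 1) (prepare_inv N)"
  proof (rule ht_Loop)
    show "ht N (prepare_inv m) count_channels (cost count_channels) (prepare_inv (Suc m))" for m
      by (rule ht_run) (simp add: count_channels_def set_simps prepare_inv_def inputs_def)
  qed (simp_all add: prepare_inv_def inputs_def)
qed

lemma ht_search:
  "ht N (prepare_inv N) (Do (IConst ''j'' 1) ;; Loop (ILe ''j'' ''N'') search_row)
     (1 + (N * (row_cost + 1) + 1)) (search_inv ({1..N} \<times> {1..N}))"
proof -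
  define I where "I m st \<longleftrightarrow> search_inv ({1..m} \<times> {1..N}) st \<and> ireg st ''j'' = Suc m" for m st
  have start: "ht N (prepare_inv N) (Do (IConst ''j'' 1)) 1 (I 0)"
    using ht_run[of "prepare_inv N" N "Do (IConst ''j'' 1)" "I 0"]
    by (simp add: I_def set_simps prepare_inv_def search_inv_def inputs_def)
  have loop: "ht N (I 0) (Loop (ILe ''j'' ''N'') search_row) (N * (row_cost + 1) + 1) (I N)"
  proof (rule ht_Loop)
    show "ht N (I m) search_row row_cost (I (Suc m))" if "m < N" for m
      unfolding I_def[abs_def] using ht_search_row[OF that] .
  qed (simp_all add: I_def search_inv_def inputs_def)
  show ?thesis
    by (rule ht_weaken[OF ht_Seq[OF start loop]]) (simp_all add: I_def)
qed

section \<open>Writing the solution\<close>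

definition write_inv :: "nat \<Rightarrow> nat \<Rightarrow> nat \<Rightarrow> state \<Rightarrow> bool" where
  "write_inv j i m st \<longleftrightarrow>
     inputs st \<and> ireg st ''i'' = Suc m \<and> ireg st ''status'' = 1 \<and>
     ireg st ''bj'' = j \<and> ireg st ''bi'' = i \<and> rreg st ''best'' = min_power j i \<and>
     rreg st ''bnu'' = level j i \<and> rreg st ''bA'' = demand j i \<and>
     rarr st ''P'' = (\<lambda>l. if l \<in> {1..m} then sol_p j i l else 0) \<and>
     rarr st ''pi'' = (\<lambda>l. if l \<in> {1..m} then sol_q j i l else 0)"

lemma ht_write_cell:
  assumes "m < N"
  shows "ht N (write_inv j i m) write_cell (cost write_cell) (write_inv j i (Suc m))"
proof (rule ht_run)
  fix st assume st: "write_inv j i m st"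
  have l: "Suc m \<in> {1..N}" "0 < lam (Suc m)"
    using assms lam_pos by simp_all
  \<comment> \<open>A further cell is right either because it is written or because its target is
    the 0 already there.\<close>
  have upd: "(\<lambda>l. if l \<in> {1..m} then f l else 0)(Suc m := f (Suc m)) = (\<lambda>l. if l \<in> {1..Suc m} then f l else 0)"
    "f (Suc m) = 0 \<Longrightarrow> (\<lambda>l. if l \<in> {1..m} then f l else 0) = (\<lambda>l. if l \<in> {1..Suc m} then f l else 0)"
    for f :: "nat \<Rightarrow> real"
    by (auto simp: fun_eq_iff le_Suc_eq)
  have p: "sol_p j i (Suc m) =
     (if Suc m = j then min_power j i - (1 + s * min_power j i) * demand j i
      else if Suc m \<le> i then (1 + s * min_power j i) * (level j i - 1 / lam (Suc m)) else 0)"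
    by (simp add: sol_p_def)
  have q: "sol_q j i (Suc m) = (if Suc m \<noteq> j \<and> Suc m \<le> i then 1 else 0)"
    by (simp add: sol_q_def chan_def)
  consider "Suc m = j" | "Suc m \<noteq> j" "Suc m \<le> i" | "Suc m \<noteq> j" "\<not> Suc m \<le> i"
    by blast
  then show "\<exists>st'. run N write_cell st = Some st' \<and> write_inv j i (Suc m) st'"
  proof cases
    case 1
    then show ?thesis
      using st l assms p q upd(1)[of "sol_p j i", symmetric] upd(2)[of "sol_q j i", symmetric]
      by (simp add: write_cell_def set_simps write_inv_def inputs_def del: One_nat_def atLeastAtMost_iff)
  next
    case 2
    then show ?thesis
      using st l assms p q upd(1)[of "sol_p j i", symmetric] upd(1)[of "sol_q j i", symmetric]
      by (simp add: write_cell_def set_simps write_inv_def inputs_def del: One_nat_def atLeastAtMost_iff)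
  next
    case 3
    then show ?thesis
      using st l assms p q upd(2)[of "sol_p j i", symmetric] upd(2)[of "sol_q j i", symmetric]
      by (simp add: write_cell_def set_simps write_inv_def inputs_def del: One_nat_def atLeastAtMost_iff)
  qed
qed

text \<open>Both arrays and both solution functions vanish outside \<open>1..N\<close>, so agreement
  on these cells is equality of functions.\<close>

lemma write_inv_solution:
  assumes "write_inv j i N st" "(j, i) \<in> candidates"
  shows "rarr st ''P'' = sol_p j i" "rarr st ''pi'' = sol_q j i"
proof -
  have j: "1 \<le> j" "j \<le> N" "i \<le> N"
    using assms(2) by (auto simp: candidates_def)
  then have "sol_p j i l = 0" "sol_q j i l = 0" if "l \<notin> {1..N}" for l
    using that by (auto simp: sol_p_def sol_q_def chan_def)
  then show "rarr st ''P'' = sol_p j i" "rarr st ''pi'' = sol_q j i"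
    using assms(1) by (simp_all add: write_inv_def fun_eq_iff del: atLeastAtMost_iff One_nat_def)
qed

lemma candidates_subset: "candidates \<subseteq> {1..N} \<times> {1..N}"
  by (auto simp: candidates_def)

lemma ht_write:
  "ht N (\<lambda>st. search_inv ({1..N} \<times> {1..N}) st \<and> ireg st ''status'' \<noteq> 0)
     (Do (IConst ''i'' 1) ;; Loop (ILe ''i'' ''N'') write_cell)
     (1 + (N * (cost write_cell + 1) + 1)) (correct_output N lam s C_I C_EH)"
    (is "ht N ?P ?c ?t ?Q")
proof -
  \<comment> \<open>Fixing the start state turns the recorded pair into constants \<open>j\<close>
    and \<open>i\<close> for \<open>write_inv\<close>.\<close>
  have "ht N (\<lambda>st'. st' = st) ?c ?t ?Q" if st: "?P st" for st
  proof -
    define j i where "j = ireg st ''bj''" and "i = ireg st ''bi''"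
    have cand: "(j, i) \<in> candidates"
      and best: "\<And>j' i'. (j', i') \<in> candidates \<Longrightarrow> min_power j i \<le> min_power j' i'"
      using st unfolding search_inv_def Int_absorb1[OF candidates_subset] j_def i_def by auto
    have "write_inv j i 0 (set_ireg ''i'' 1 st)"
      using st by (auto simp: set_simps write_inv_def search_inv_def inputs_def j_def i_def)
    then have start: "ht N (\<lambda>st'. st' = st) (Do (IConst ''i'' 1)) 1 (write_inv j i 0)"
      using ht_run[of "\<lambda>st'. st' = st" N "Do (IConst ''i'' 1)" "write_inv j i 0"] by simp
    have loop: "ht N (write_inv j i 0) (Loop (ILe ''i'' ''N'') write_cell)
        (N * (cost write_cell + 1) + 1) (write_inv j i N)"
      by (rule ht_Loop) (simp_all add: ht_write_cell, simp_all add: write_inv_def inputs_def)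
    show ?thesis
    proof (rule ht_weaken[OF ht_Seq[OF start loop]])
      fix st' assume st': "write_inv j i N st'"
      then have "ireg st' ''status'' = 1"
        by (simp add: write_inv_def)
      then show "correct_output N lam s C_I C_EH st'"
        using optimal_candidate[OF cand best]
        by (simp add: correct_output_def write_inv_solution[OF st' cand])
    qed simp_all
  qed
  then show ?thesis
    unfolding ht_def by metis
qed

section \<open>Total running time and conclusion\<close>

definition total_cost :: nat where
  "total_cost =
     (1 + (N * (cost count_channels + 1) + 1)) + ((1 + (N * (row_cost + 1) + 1)) +
      (1 + (1 + (1 + (N * (cost write_cell + 1) + 1)))))"

lemma ht_solver:
  "ht N (\<lambda>st. st = initial N lam s C_I C_EH) solver total_cost (correct_output N lam s C_I C_EH)"
proof -
  let ?S = "search_inv ({1..N} \<times> {1..N})"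
  have zero: "ht N ?S (Do (IConst ''zero'' 0)) 1 (\<lambda>st. ?S st \<and> ireg st ''zero'' = 0)"
    using ht_run[of ?S N "Do (IConst ''zero'' 0)" "\<lambda>st. ?S st \<and> ireg st ''zero'' = 0"]
    by (simp add: set_simps search_inv_def inputs_def del: One_nat_def)
  have "correct_output N lam s C_I C_EH st" if "?S st" "ireg st ''status'' = 0" for st
    using that no_candidate_infeasible
    unfolding search_inv_def Int_absorb1[OF candidates_subset] correct_output_def by auto
  then have skip: "ht N (\<lambda>st. (?S st \<and> ireg st ''zero'' = 0) \<and> holds (IEq ''status'' ''zero'') st) Skip
      (1 + (N * (cost write_cell + 1) + 1)) (correct_output N lam s C_I C_EH)"
    using exec.Skip unfolding ht_def by fastforce
  have "ht N (\<lambda>st. (?S st \<and> ireg st ''zero'' = 0) \<and> \<not> holds (IEq ''status'' ''zero'') st)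
      (Do (IConst ''i'' 1) ;; Loop (ILe ''i'' ''N'') write_cell)
      (1 + (N * (cost write_cell + 1) + 1)) (correct_output N lam s C_I C_EH)"
    by (rule ht_weaken[OF ht_write]) auto
  then show ?thesis
    unfolding solver_def total_cost_def
    by (intro ht_Seq[OF ht_prepare] ht_Seq[OF ht_search] ht_Seq[OF zero] ht_Cond[OF skip])
qed

text \<open>\<open>N\<close> rows of \<open>N\<close> steps give the quadratic term; linear and
  constant terms are absorbed by \<open>N \<le> N ^ 2\<close> and \<open>1 \<le> N ^ 2\<close>. The
  factor 1000 generously exceeds the sum of the coefficients.\<close>

lemma total_cost_le: "total_cost \<le> 1000 * N ^ 2"
proof -
  have "1 \<le> N"
    using input by (simp add: valid_input_def)
  then have "1 \<le> N ^ 2" "N \<le> N ^ 2"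
    by (simp_all add: power2_eq_square)
  moreover have "N * row_cost = N * (cost start_row + 2) + N ^ 2 * (step_cost + 2)"
    by (simp add: row_cost_def power2_eq_square algebra_simps)
  ultimately show ?thesis
    by (simp add: total_cost_def step_cost_def count_channels_def start_row_def extend_def
        compute_power_def update_best_def record_best_def write_cell_def algebra_simps)
qed

end

theorem mainTheorem3:
  "\<exists>(c :: prog) (T :: nat \<Rightarrow> real).
     T \<in> O(\<lambda>N. real N ^ 2) \<and>
     (\<forall>(N :: nat) (lam :: nat \<Rightarrow> real) (s :: real) (C_I :: real) (C_EH :: real).
        valid_input N lam s C_I C_EH \<longrightarrow>
        (\<exists>t st. exec N c (initial N lam s C_I C_EH) t st \<and> real t \<le> T N \<and>
                correct_output N lam s C_I C_EH st))"
proof (rule exI[of _ solver], rule exI[of _ "\<lambda>N. 1000 * real N ^ 2"], intro conjI allI impI)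
  show "(\<lambda>N. 1000 * real N ^ 2) \<in> O(\<lambda>N. real N ^ 2)"
    by simp
  fix N lam s C_I C_EH
  assume "valid_input N lam s C_I C_EH"
  then interpret swipt N lam s C_I C_EH
    by unfold_locales
  obtain t st where "t \<le> total_cost" "exec N solver (initial N lam s C_I C_EH) t st"
    "correct_output N lam s C_I C_EH st"
    using ht_solver unfolding ht_def by blast
  moreover have "real t \<le> 1000 * real N ^ 2"
    using order_trans[OF \<open>t \<le> total_cost\<close> total_cost_le] by (metis of_nat_le_iff of_nat_mult of_nat_numeral of_nat_power)
  ultimately show "\<exists>t st. exec N solver (initial N lam s C_I C_EH) t st \<and> real t \<le> 1000 * real N ^ 2 \<and>
      correct_output N lam s C_I C_EH st"
    by blast
qed

end
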